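(* Let $n\ge 0$ and $m$ be integers with $|m|\le n$ and $n-|m|$ even, and let $A=(x_A,y_A)$ and $B=(x_B,y_B)$ be two distinct points of the closed unit disk in $\mathbb{R}^2$. For $t\in[-1,1]$ put $$x(t)=\frac{(1-t)x_A+(1+t)x_B}{2},\qquad y(t)=\frac{(1-t)y_A+(1+t)y_B}{2},\qquad r(t)=\sqrt{x(t)^2+y(t)^2},$$ let $\theta(t)$ be a polar angle of the point $(x(t),y(t))$, and let $C=(x_Ay_B-y_Ax_B)/2$. Then the function $$A_n^m(t)=C\,\frac{Q_n^m(r(t))\,e^{-im\theta(t)}}{r(t)^2}$$ is a polynomial function of $t$ (with complex coefficients) of degree at most $n$; that is, there is a polynomial $p\in\mathbb{C}[t]$ of degree at most $n$ such that $A_n^m(t)=p(t)$ for all $t\in[-1,1]$ with $r(t)\neq 0$.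
   Context: For integers $n\ge 0$ and $m$ with $|m|\le n$ and $n-|m|$ even, the Zernike radial polynomial is $$R_n^{m}(r)=R_n^{|m|}(r)=\sum_{k=0}^{(n-|m|)/2}(-1)^k\frac{(n-k)!}{k!\left(\frac{n+|m|}{2}-k\right)!\left(\frac{n-|m|}{2}-k\right)!}\,r^{n-2k},$$ and its radial primitive is $$Q_n^m(r)=\int_0^r s\,R_n^m(s)\,ds.$$ Here $i=\sqrt{-1}$. A polar angle of a point $(x,y)\ne(0,0)$ is a real $\theta$ with $(x,y)=\sqrt{x^2+y^2}\,(\cos\theta,\sin\theta)$; the value $e^{-im\theta}$ does not depend on its choice. The zero polynomial is regarded as having degree at most $n$. *)

theory Defs
  imports "HOL-Analysis.Analysis" "HOL-Computational_Algebra.Polynomial"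
begin

text \<open>
  Zernike radial polynomials. The natural-number subtractions and halvings below are exact
  when \<open>\<bar>m\<bar> \<le> int n\<close> and \<open>int n - \<bar>m\<bar>\<close> is even, the only case of interest.
\<close>

definition zernike_R :: "nat \<Rightarrow> int \<Rightarrow> real \<Rightarrow> real" where
  "zernike_R n m r =
     (\<Sum>k = 0..(n - nat \<bar>m\<bar>) div 2.
        (-1) ^ k * (fact (n - k) /
          (fact k * fact ((n + nat \<bar>m\<bar>) div 2 - k) * fact ((n - nat \<bar>m\<bar>) div 2 - k)))
        * r ^ (n - 2 * k))"

definition zernike_Q :: "nat \<Rightarrow> int \<Rightarrow> real \<Rightarrow> real" where
  "zernike_Q n m r = (LBINT s=0..r. s * zernike_R n m s)"

definition is_polar_angle :: "real \<Rightarrow> real \<times> real \<Rightarrow> bool" where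
  "is_polar_angle \<theta> P \<longleftrightarrow>
     P = (sqrt ((fst P)\<^sup>2 + (snd P)\<^sup>2) * cos \<theta>, sqrt ((fst P)\<^sup>2 + (snd P)\<^sup>2) * sin \<theta>)"

definition chord_x :: "real \<times> real \<Rightarrow> real \<times> real \<Rightarrow> real \<Rightarrow> real" where
  "chord_x A B t = ((1 - t) * fst A + (1 + t) * fst B) / 2"

definition chord_y :: "real \<times> real \<Rightarrow> real \<times> real \<Rightarrow> real \<Rightarrow> real" where
  "chord_y A B t = ((1 - t) * snd A + (1 + t) * snd B) / 2"

definition chord_r :: "real \<times> real \<Rightarrow> real \<times> real \<Rightarrow> real \<Rightarrow> real" where
  "chord_r A B t = sqrt ((chord_x A B t)\<^sup>2 + (chord_y A B t)\<^sup>2)"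

definition chord_C :: "real \<times> real \<Rightarrow> real \<times> real \<Rightarrow> real" where
  "chord_C A B = (fst A * snd B - snd A * fst B) / 2"

text \<open>The function \<open>\<theta>\<close> is a choice of polar angle along the chord.\<close>

definition zernike_A ::
  "nat \<Rightarrow> int \<Rightarrow> real \<times> real \<Rightarrow> real \<times> real \<Rightarrow> (real \<Rightarrow> real) \<Rightarrow> real \<Rightarrow> complex" where
  "zernike_A n m A B \<theta> t =
     complex_of_real (chord_C A B) *
       (complex_of_real (zernike_Q n m (chord_r A B t)) *
          exp (- (\<i> * of_int m * complex_of_real (\<theta> t))))
       / complex_of_real ((chord_r A B t)\<^sup>2)"

end

theory Submission
  imports Defs
begin

text \<open>
  Integrating termwise, \<open>Q\<^sub>n\<^sup>m(r) / r\<^sup>2\<close> is a combination of the powers \<open>r\<^bsup>n-2k\<^esup> = (r\<^sup>2)\<^bsup>j\<^esup> r\<^bsup>|m|\<^esup>\<close>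
  with \<open>j = (n - |m|)/2 - k\<close>. Along the chord, \<open>r\<^sup>2 = x\<^sup>2 + y\<^sup>2\<close> is a quadratic polynomial in \<open>t\<close>, and
  \<open>r\<^bsup>|m|\<^esup> exp (-im\<theta>)\<close> is the \<open>|m|\<close>-th power of the linear polynomial \<open>x \<mp> iy\<close>, with sign opposite to
  that of \<open>m\<close>. Hence each term has degree at most \<open>2j + |m| = n - 2k\<close>.
\<close>

lemma degree_power_le_mult:
  assumes "degree p \<le> d"
  shows "degree (p ^ k) \<le> d * k"
  using degree_power_le[of p k] mult_le_mono1[OF assms, of k] by (rule order.trans)

definition zernike_coeff :: "nat \<Rightarrow> int \<Rightarrow> nat \<Rightarrow> real" where
  "zernike_coeff n m k =
     (-1) ^ k * (fact (n - k) /
       (fact k * fact ((n + nat \<bar>m\<bar>) div 2 - k) * fact ((n - nat \<bar>m\<bar>) div 2 - k)))"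

text \<open>The right-hand side is an antiderivative of \<open>s * zernike_R n m s\<close>. It
  vanishes at 0 because every exponent is at least 2, so the fundamental theorem of calculus on
  [0, r] gives the claim.\<close>

lemma zernike_Q_eq_sum:
  assumes "0 \<le> r"
  shows "zernike_Q n m r =
    (\<Sum>k = 0..(n - nat \<bar>m\<bar>) div 2.
       zernike_coeff n m k / (n - 2 * k + 2) * r ^ (n - 2 * k + 2))"
proof -
  define F where "F s = (\<Sum>k = 0..(n - nat \<bar>m\<bar>) div 2.
       zernike_coeff n m k / (n - 2 * k + 2) * s ^ (n - 2 * k + 2))" for s :: real
  have F': "(F has_vector_derivative s * zernike_R n m s) (at s within S)" for s S
  proof -
    have D: "((\<lambda>s. a / real (d + 2) * s ^ (d + 2)) has_real_derivative s * (a * s ^ d)) (at s within S)"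
      for a :: real and d :: nat
      by (rule derivative_eq_intros refl | simp add: field_simps)+
    have "(F has_real_derivative
        (\<Sum>k = 0..(n - nat \<bar>m\<bar>) div 2. s * (zernike_coeff n m k * s ^ (n - 2 * k)))) (at s within S)"
      unfolding F_def by (intro DERIV_sum D)
    then show ?thesis
      by (simp add: zernike_R_def zernike_coeff_def sum_distrib_left
          has_real_derivative_iff_has_vector_derivative)
  qed
  have "(LBINT s=ereal 0..ereal r. s * zernike_R n m s) = F r - F 0"
    using assms
    by (intro interval_integral_FTC_finite F' continuous_intros) (simp add: zernike_R_def continuous_intros)
  then show ?thesis
    by (simp add: zernike_Q_def F_def zero_ereal_def)
qed

theorem proposition2:
  fixes n :: nat and m :: int and A B :: "real \<times> real" and \<theta> :: "real \<Rightarrow> real"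
  assumes "\<bar>m\<bar> \<le> int n" and "even (int n - \<bar>m\<bar>)"
    and "A \<in> cball (0, 0) 1" and "B \<in> cball (0, 0) 1" and "A \<noteq> B"
    and "\<And>t. t \<in> {-1..1} \<Longrightarrow> chord_r A B t \<noteq> 0 \<Longrightarrow>
           is_polar_angle (\<theta> t) (chord_x A B t, chord_y A B t)"
  shows "\<exists>p :: complex poly. degree p \<le> n \<and>
           (\<forall>t\<in>{-1..1}. chord_r A B t \<noteq> 0 \<longrightarrow>
              zernike_A n m A B \<theta> t = poly p (complex_of_real t))"
proof -
  define M where "M = nat \<bar>m\<bar>"
  define J where "J = (n - M) div 2"
  \<comment> \<open>The sign of \<open>m\<close>; for \<open>m = 0\<close> either choice would do,
    since then \<open>M = 0\<close>.\<close>
  define \<epsilon> :: real where "\<epsilon> = (if 0 \<le> m then 1 else -1)"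
  have "int M = \<bar>m\<bar>"
    by (simp add: M_def)
  with assms(1,2) have "M \<le> n" "even (n - M)"
    by presburger+
  \<comment> \<open>From here on this exact equation replaces parity and truncated halving.\<close>
  then have n: "n = M + 2 * J"
    by (simp add: J_def)
  have m: "of_int m = complex_of_real \<epsilon> * of_nat M"
    by (simp add: \<epsilon>_def M_def)
  \<comment> \<open>Expanding the chord in powers of \<open>t\<close> gives the midpoint of the
    endpoints as constant term and half their difference as slope.\<close>
  define X Y :: "complex poly" where
    "X = [:of_real ((fst A + fst B) / 2), of_real ((fst B - fst A) / 2):]" and
    "Y = [:of_real ((snd A + snd B) / 2), of_real ((snd B - snd A) / 2):]"
  have X: "poly X (of_real t) = of_real (chord_x A B t)"
    and Y: "poly Y (of_real t) = of_real (chord_y A B t)" for t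
    by (simp_all add: X_def Y_def chord_x_def chord_y_def field_simps)
  define U where "U = X - smult (\<i> * of_real \<epsilon>) Y"
  define W where "W = X\<^sup>2 + Y\<^sup>2"
  define c where "c k = zernike_coeff n m k / (n - 2 * k + 2)" for k
  \<comment> \<open>Each power of \<open>r\<close> left after division by the squared radius splits
    as \<open>(r^2)^(J - k) * r^M\<close>. Here \<open>W\<close> stands for the squared radius, and
    \<open>U ^ M\<close> absorbs \<open>r^M\<close> together with the phase.\<close>
  define p where "p = smult (of_real (chord_C A B))
    (\<Sum>k = 0..J. smult (of_real (c k)) (W ^ (J - k) * U ^ M))"

  have XY: "degree X \<le> 1" "degree Y \<le> 1"
    by (simp_all add: X_def Y_def)
  have "degree U \<le> 1"
    unfolding U_def using XY by (meson degree_diff_le degree_smult_le le_trans)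
  then have U_pow: "degree (U ^ M) \<le> M"
    using degree_power_le_mult[of U 1 M] by simp
  have "degree (X\<^sup>2) \<le> 2" "degree (Y\<^sup>2) \<le> 2"
    using XY degree_power_le_mult[of _ 1 2] by (simp_all only: mult_1)
  then have "degree W \<le> 2"
    unfolding W_def by (rule degree_add_le)
  then have W_pow: "degree (W ^ j) \<le> 2 * j" for j
    by (rule degree_power_le_mult)
  \<comment> \<open>The bound is \<open>2 * (J - k) + M\<close>, at most
    \<open>2 * J + M = n\<close>.\<close>
  have term_degree: "degree (W ^ (J - k) * U ^ M) \<le> n" for k
    using degree_mult_le[of "W ^ (J - k)" "U ^ M"] W_pow[of "J - k"] U_pow n by linarith
  have "degree p \<le> n"
    unfolding p_def
    by (intro order.trans[OF degree_smult_le] degree_sum_le term_degree finite_atLeastAtMost)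

  moreover have "zernike_A n m A B \<theta> t = poly p (of_real t)"
    if t: "t \<in> {-1..1}" and r0: "chord_r A B t \<noteq> 0" for t
  proof -
    define r where "r = chord_r A B t"
    have r: "0 \<le> r" "r \<noteq> 0"
      using r0 by (simp_all add: r_def chord_r_def)
    have xy: "chord_x A B t = r * cos (\<theta> t)" "chord_y A B t = r * sin (\<theta> t)"
      using assms(6)[OF t r0] by (auto simp: is_polar_angle_def r_def chord_r_def)
    \<comment> \<open>For negative \<open>m\<close> the value is \<open>x + iy\<close>, with phase
      \<open>cis (\<theta> t)\<close>; otherwise it is the conjugate.\<close>
    have "poly U (of_real t) = of_real r * cis (- (\<epsilon> * \<theta> t))"
      by (auto simp: U_def X Y xy \<epsilon>_def complex_eq_iff)
    moreover have "cis (- (\<epsilon> * \<theta> t)) ^ M = exp (- (\<i> * of_int m * of_real (\<theta> t)))"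
      unfolding m cis_conv_exp exp_of_nat_mult[symmetric] by (simp add: mult_ac)
    ultimately have U_val: "poly U (of_real t) ^ M =
        of_real r ^ M * exp (- (\<i> * of_int m * of_real (\<theta> t)))"
      by (simp add: power_mult_distrib)
    have "r\<^sup>2 = (chord_x A B t)\<^sup>2 + (chord_y A B t)\<^sup>2"
      by (simp add: r_def chord_r_def)
    then have W_val: "poly W (of_real t) = of_real r ^ 2"
      by (simp add: W_def X Y flip: of_real_power of_real_add)
    \<comment> \<open>Integration raised every exponent by 2, so dividing by the nonzero
      \<open>r^2\<close> leaves no negative power.\<close>
    have "zernike_Q n m r / r\<^sup>2 = (\<Sum>k = 0..J. c k * r ^ (n - 2 * k))"
      using r by (simp add: zernike_Q_eq_sum c_def J_def M_def sum_divide_distrib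
          power_add power2_eq_square)
    \<comment> \<open>In the range of summation \<open>k \<le> J\<close>, so the natural
      subtractions are exact and \<open>n - 2 * k = 2 * (J - k) + M\<close>.\<close>
    also have "\<dots> = (\<Sum>k = 0..J. c k * ((r\<^sup>2) ^ (J - k) * r ^ M))"
      by (intro sum.cong refl) (auto simp: n simp flip: power_mult power_add intro!: arg_cong[where f = "power r"])
    finally have Q: "complex_of_real (zernike_Q n m r) / of_real (r\<^sup>2) =
        (\<Sum>k = 0..J. of_real (c k) * ((of_real r ^ 2) ^ (J - k) * of_real r ^ M))"
      by (simp flip: of_real_divide of_real_power of_real_mult of_real_sum)
    have "zernike_A n m A B \<theta> t = of_real (chord_C A B) *
        (complex_of_real (zernike_Q n m r) / of_real (r\<^sup>2) *
          exp (- (\<i> * of_int m * of_real (\<theta> t))))"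
      by (simp add: zernike_A_def r_def)
    also have "\<dots> = poly p (of_real t)"
      unfolding Q p_def
      by (simp add: poly_sum W_val U_val sum_distrib_left sum_distrib_right mult_ac)
    finally show ?thesis .
  qed
  ultimately show ?thesis by blast
qed

end
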